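(* Let $(\mathbb A,\mathsf E,\mathsf M)$ be a context, $(X,\mu)$ and $(Y,\phi)$ internal preneighbourhood spaces and $f:X\to Y$ a morphism of $\mathbb A$. Consider the statements: (a) for every $p\in\mathrm{Sub}(X)$, $\exists_f(\mathrm{cl}_\mu p)\leq\mathrm{cl}_\phi(\exists_f p)$; (b) for every $p\in\mathrm{Sub}(X)$, $\exists_f(\widehat{\mathrm{cl}}_\mu p)\leq\widehat{\mathrm{cl}}_\phi(\exists_f p)$; (c) for every $t\in\mathfrak C_\phi$, $f^{-1}t\in\mathfrak C_\mu$; (d) for every $p\in\mathrm{Sub}(X)$, $\widehat{\mathrm{cl}}_\phi(\exists_f p)=\widehat{\mathrm{cl}}_\phi(\exists_f(\mathrm{cl}_\mu p))$. Then (a) implies (b), and the statements (b), (c), (d) are equivalent.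
   Context: A context is a triple $(\mathbb A,\mathsf E,\mathsf M)$ where $\mathbb A$ is a finitely complete category with finite coproducts, $(\mathsf E,\mathsf M)$ is a proper factorization system on $\mathbb A$ ($\mathsf E\subseteq$ epimorphisms, $\mathsf M\subseteq$ monomorphisms), and for each object $X$ the poset $\mathrm{Sub}(X)$ of admissible subobjects of $X$ ($\mathsf M$-morphisms with codomain $X$, equivalent ones identified) is a complete lattice, with largest element $\mathrm{id}_X$ and smallest element $\sigma_X$ (the $\mathsf M$-part of the factorization of the unique morphism from the initial object to $X$). For $f:X\to Y$, $\exists_f m$ is the $\mathsf M$-part of the factorization of $f\circ m$ ($m\in\mathrm{Sub}(X)$) and $f^{-1}n$ is the pullback of $n\in\mathrm{Sub}(Y)$ along $f$; $\exists_f\dashv f^{-1}$. A filter on $X$ is an up-closed subset of $\mathrm{Sub}(X)$ closed under finite meets; filters $\mathrm{Fil}(X)$ are ordered by inclusion. A preneighbourhood system on $X$ is an order preserving map $\mu:\mathrm{Sub}(X)^{\mathrm{op}}\to\mathrm{Fil}(X)$ with $\mu(\sigma_X)=\mathrm{Sub}(X)$ and $p\in\mu(m)\Rightarrow m\leq p$; $(X,\mu)$ is then an internal preneighbourhood space. Define $\mathtt{Far}_\mu p=\{x\in\mathrm{Sub}(X):(\exists u\in\mu(x))(u\wedge p=\sigma_X)\}$, $\mathrm{cl}_\mu p=\bigvee\{x\in\mathrm{Sub}(X): p\not< x\text{ and }x\notin\mathtt{Far}_\mu p\}$, $\mathfrak C_\mu=\{p:\mathrm{cl}_\mu p=p\}$,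 and $\widehat{\mathrm{cl}}_\mu p=\bigwedge\{t\in\mathfrak C_\mu: p\leq t\}$. *)

theory Defs
  imports "HOL-Algebra.Complete_Lattice"
begin

section \<open>Categories\<close>

record ('o, 'm) cat =
  Obj :: "'o set"
  Arr :: "'m set"
  Dom :: "'m \<Rightarrow> 'o"
  Cod :: "'m \<Rightarrow> 'o"
  Id :: "'o \<Rightarrow> 'm"
  Comp :: "'m \<Rightarrow> 'm \<Rightarrow> 'm" (infixl "\<cdot>\<index>" 70)

definition Hom :: "('o, 'm, 'r) cat_scheme \<Rightarrow> 'o \<Rightarrow> 'o \<Rightarrow> 'm set" where
  "Hom C X Y = {f \<in> Arr C. Dom C f = X \<and> Cod C f = Y}"

locale category =
  fixes C :: "('o, 'm, 'r) cat_scheme" (structure)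
  assumes Dom_closed: "f \<in> Arr C \<Longrightarrow> Dom C f \<in> Obj C"
    and Cod_closed: "f \<in> Arr C \<Longrightarrow> Cod C f \<in> Obj C"
    and Id_closed: "X \<in> Obj C \<Longrightarrow> Id C X \<in> Hom C X X"
    and Comp_closed: "\<lbrakk>f \<in> Hom C X Y; g \<in> Hom C Y Z\<rbrakk> \<Longrightarrow> g \<cdot> f \<in> Hom C X Z"
    and Comp_assoc: "\<lbrakk>f \<in> Hom C W X; g \<in> Hom C X Y; h \<in> Hom C Y Z\<rbrakk>
                      \<Longrightarrow> h \<cdot> g \<cdot> f = h \<cdot> (g \<cdot> f)"
    and Comp_Id: "f \<in> Hom C X Y \<Longrightarrow> f \<cdot> Id C X = f"
    and Id_Comp: "f \<in> Hom C X Y \<Longrightarrow> Id C Y \<cdot> f = f"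

definition is_mono :: "('o, 'm, 'r) cat_scheme \<Rightarrow> 'm \<Rightarrow> bool" where
  "is_mono C m \<longleftrightarrow> m \<in> Arr C \<and>
     (\<forall>T g h. g \<in> Hom C T (Dom C m) \<longrightarrow> h \<in> Hom C T (Dom C m) \<longrightarrow>
        m \<cdot>\<^bsub>C\<^esub> g = m \<cdot>\<^bsub>C\<^esub> h \<longrightarrow> g = h)"

definition is_epi :: "('o, 'm, 'r) cat_scheme \<Rightarrow> 'm \<Rightarrow> bool" where
  "is_epi C e \<longleftrightarrow> e \<in> Arr C \<and>
     (\<forall>T g h. g \<in> Hom C (Cod C e) T \<longrightarrow> h \<in> Hom C (Cod C e) T \<longrightarrow>
        g \<cdot>\<^bsub>C\<^esub> e = h \<cdot>\<^bsub>C\<^esub> e \<longrightarrow> g = h)"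

definition is_iso :: "('o, 'm, 'r) cat_scheme \<Rightarrow> 'm \<Rightarrow> bool" where
  "is_iso C f \<longleftrightarrow> f \<in> Arr C \<and>
     (\<exists>g \<in> Hom C (Cod C f) (Dom C f).
        g \<cdot>\<^bsub>C\<^esub> f = Id C (Dom C f) \<and> f \<cdot>\<^bsub>C\<^esub> g = Id C (Cod C f))"

definition is_initial :: "('o, 'm, 'r) cat_scheme \<Rightarrow> 'o \<Rightarrow> bool" where
  "is_initial C I \<longleftrightarrow> I \<in> Obj C \<and> (\<forall>X \<in> Obj C. \<exists>!f. f \<in> Hom C I X)"

definition is_diagram ::
    "('j, 'k, 's) cat_scheme \<Rightarrow> ('o, 'm, 'r) cat_scheme \<Rightarrow> ('j \<Rightarrow> 'o) \<Rightarrow> ('k \<Rightarrow> 'm) \<Rightarrow> bool" where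
  "is_diagram J C F G \<longleftrightarrow>
     (\<forall>j \<in> Obj J. F j \<in> Obj C) \<and>
     (\<forall>u \<in> Arr J. G u \<in> Hom C (F (Dom J u)) (F (Cod J u))) \<and>
     (\<forall>j \<in> Obj J. G (Id J j) = Id C (F j)) \<and>
     (\<forall>u \<in> Arr J. \<forall>v \<in> Arr J. Cod J u = Dom J v \<longrightarrow> G (v \<cdot>\<^bsub>J\<^esub> u) = G v \<cdot>\<^bsub>C\<^esub> G u)"

definition is_cone ::
    "('j, 'k, 's) cat_scheme \<Rightarrow> ('o, 'm, 'r) cat_scheme \<Rightarrow> ('j \<Rightarrow> 'o) \<Rightarrow> ('k \<Rightarrow> 'm)
       \<Rightarrow> 'o \<Rightarrow> ('j \<Rightarrow> 'm) \<Rightarrow> bool" where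
  "is_cone J C F G T \<tau> \<longleftrightarrow> T \<in> Obj C \<and> (\<forall>j \<in> Obj J. \<tau> j \<in> Hom C T (F j)) \<and>
     (\<forall>u \<in> Arr J. G u \<cdot>\<^bsub>C\<^esub> \<tau> (Dom J u) = \<tau> (Cod J u))"

definition is_limit ::
    "('j, 'k, 's) cat_scheme \<Rightarrow> ('o, 'm, 'r) cat_scheme \<Rightarrow> ('j \<Rightarrow> 'o) \<Rightarrow> ('k \<Rightarrow> 'm)
       \<Rightarrow> 'o \<Rightarrow> ('j \<Rightarrow> 'm) \<Rightarrow> bool" where
  "is_limit J C F G L \<pi> \<longleftrightarrow> is_cone J C F G L \<pi> \<and>
     (\<forall>T \<tau>. is_cone J C F G T \<tau> \<longrightarrow>
        (\<exists>!h. h \<in> Hom C T L \<and> (\<forall>j \<in> Obj J. \<pi> j \<cdot>\<^bsub>C\<^esub> h = \<tau> j)))"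

text \<open>Every finite category is isomorphic to one whose objects and arrows are natural numbers,
  so it is enough to let the shapes range over those.\<close>

definition finitely_complete :: "('o, 'm, 'r) cat_scheme \<Rightarrow> bool" where
  "finitely_complete C \<longleftrightarrow>
     (\<forall>(J :: (nat, nat) cat) F G.
        category J \<longrightarrow> finite (Obj J) \<longrightarrow> finite (Arr J) \<longrightarrow> is_diagram J C F G \<longrightarrow>
        (\<exists>L \<pi>. is_limit J C F G L \<pi>))"

definition is_coproduct ::
    "('o, 'm, 'r) cat_scheme \<Rightarrow> 'i set \<Rightarrow> ('i \<Rightarrow> 'o) \<Rightarrow> 'o \<Rightarrow> ('i \<Rightarrow> 'm) \<Rightarrow> bool" where
  "is_coproduct C I A S \<iota> \<longleftrightarrow> S \<in> Obj C \<and> (\<forall>i \<in> I. \<iota> i \<in> Hom C (A i) S) \<and>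
     (\<forall>T \<tau>. T \<in> Obj C \<longrightarrow> (\<forall>i \<in> I. \<tau> i \<in> Hom C (A i) T) \<longrightarrow>
        (\<exists>!h. h \<in> Hom C S T \<and> (\<forall>i \<in> I. h \<cdot>\<^bsub>C\<^esub> \<iota> i = \<tau> i)))"

definition has_finite_coproducts :: "('o, 'm, 'r) cat_scheme \<Rightarrow> bool" where
  "has_finite_coproducts C \<longleftrightarrow>
     (\<forall>(I :: nat set) A. finite I \<longrightarrow> (\<forall>i \<in> I. A i \<in> Obj C) \<longrightarrow>
        (\<exists>S \<iota>. is_coproduct C I A S \<iota>))"

text \<open>\<open>m\<close> is a pullback of \<open>n\<close> along \<open>f\<close>, with \<open>g\<close> the remaining side of the square.\<close>

definition is_pullback :: "('o, 'm, 'r) cat_scheme \<Rightarrow> 'm \<Rightarrow> 'm \<Rightarrow> 'm \<Rightarrow> 'm \<Rightarrow> bool" where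
  "is_pullback C f n m g \<longleftrightarrow>
     f \<in> Arr C \<and> n \<in> Arr C \<and> Cod C f = Cod C n \<and>
     m \<in> Hom C (Dom C m) (Dom C f) \<and> g \<in> Hom C (Dom C m) (Dom C n) \<and>
     f \<cdot>\<^bsub>C\<^esub> m = n \<cdot>\<^bsub>C\<^esub> g \<and>
     (\<forall>T a b. a \<in> Hom C T (Dom C f) \<longrightarrow> b \<in> Hom C T (Dom C n) \<longrightarrow>
        f \<cdot>\<^bsub>C\<^esub> a = n \<cdot>\<^bsub>C\<^esub> b \<longrightarrow>
        (\<exists>!h. h \<in> Hom C T (Dom C m) \<and> m \<cdot>\<^bsub>C\<^esub> h = a \<and> g \<cdot>\<^bsub>C\<^esub> h = b))"


section \<open>Proper factorization systems and admissible subobjects\<close>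

definition is_factorization ::
    "('o, 'm, 'r) cat_scheme \<Rightarrow> 'm set \<Rightarrow> 'm set \<Rightarrow> 'm \<Rightarrow> 'm \<Rightarrow> 'm \<Rightarrow> bool" where
  "is_factorization C E M f e m \<longleftrightarrow>
     e \<in> E \<and> m \<in> M \<and> Cod C e = Dom C m \<and> f = m \<cdot>\<^bsub>C\<^esub> e"

definition factorization_system ::
    "('o, 'm, 'r) cat_scheme \<Rightarrow> 'm set \<Rightarrow> 'm set \<Rightarrow> bool" where
  "factorization_system C E M \<longleftrightarrow>
     E \<subseteq> Arr C \<and> M \<subseteq> Arr C \<and>
     (\<forall>f. is_iso C f \<longrightarrow> f \<in> E \<and> f \<in> M) \<and>
     (\<forall>f \<in> E. \<forall>g \<in> E. Cod C f = Dom C g \<longrightarrow> g \<cdot>\<^bsub>C\<^esub> f \<in> E) \<and>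
     (\<forall>f \<in> M. \<forall>g \<in> M. Cod C f = Dom C g \<longrightarrow> g \<cdot>\<^bsub>C\<^esub> f \<in> M) \<and>
     (\<forall>f \<in> Arr C. \<exists>e m. is_factorization C E M f e m) \<and>
     (\<forall>e \<in> E. \<forall>m \<in> M. \<forall>u \<in> Hom C (Dom C e) (Dom C m). \<forall>v \<in> Hom C (Cod C e) (Cod C m).
        m \<cdot>\<^bsub>C\<^esub> u = v \<cdot>\<^bsub>C\<^esub> e \<longrightarrow>
        (\<exists>!d. d \<in> Hom C (Cod C e) (Dom C m) \<and> d \<cdot>\<^bsub>C\<^esub> e = u \<and> m \<cdot>\<^bsub>C\<^esub> d = v))"

definition proper_factorization_system ::
    "('o, 'm, 'r) cat_scheme \<Rightarrow> 'm set \<Rightarrow> 'm set \<Rightarrow> bool" where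
  "proper_factorization_system C E M \<longleftrightarrow>
     factorization_system C E M \<and> (\<forall>e \<in> E. is_epi C e) \<and> (\<forall>m \<in> M. is_mono C m)"

definition mono_le :: "('o, 'm, 'r) cat_scheme \<Rightarrow> 'm \<Rightarrow> 'm \<Rightarrow> bool" where
  "mono_le C m n \<longleftrightarrow> (\<exists>g \<in> Hom C (Dom C m) (Dom C n). m = n \<cdot>\<^bsub>C\<^esub> g)"

definition mono_equiv :: "('o, 'm, 'r) cat_scheme \<Rightarrow> 'm set \<Rightarrow> 'o \<Rightarrow> ('m \<times> 'm) set" where
  "mono_equiv C M X =
     {(m, n). m \<in> M \<and> n \<in> M \<and> Cod C m = X \<and> Cod C n = X \<and> mono_le C m n \<and> mono_le C n m}"

definition Sub :: "('o, 'm, 'r) cat_scheme \<Rightarrow> 'm set \<Rightarrow> 'o \<Rightarrow> 'm set gorder" where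
  "Sub C M X =
     \<lparr>carrier = {m \<in> M. Cod C m = X} // mono_equiv C M X,
      eq = (=),
      le = (\<lambda>p q. \<exists>m \<in> p. \<exists>n \<in> q. mono_le C m n)\<rparr>"

text \<open>Admissible subobjects are equivalence classes. The next three constructions are determined
  only up to isomorphism, and each is given as the set of all of its possible results; in a context
  this set is exactly one equivalence class.\<close>

definition sub_bot :: "('o, 'm, 'r) cat_scheme \<Rightarrow> 'm set \<Rightarrow> 'm set \<Rightarrow> 'o \<Rightarrow> 'm set" where
  "sub_bot C E M X =
     {m. \<exists>I i e. is_initial C I \<and> i \<in> Hom C I X \<and> is_factorization C E M i e m}"

definition sub_image :: "('o, 'm, 'r) cat_scheme \<Rightarrow> 'm set \<Rightarrow> 'm set \<Rightarrow> 'm \<Rightarrow> 'm set \<Rightarrow> 'm set" where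
  "sub_image C E M f p = {n. \<exists>m \<in> p. \<exists>e. is_factorization C E M (f \<cdot>\<^bsub>C\<^esub> m) e n}"

definition sub_preimage :: "('o, 'm, 'r) cat_scheme \<Rightarrow> 'm \<Rightarrow> 'm set \<Rightarrow> 'm set" where
  "sub_preimage C f q = {m. \<exists>n \<in> q. \<exists>g. is_pullback C f n m g}"

definition is_context :: "('o, 'm, 'r) cat_scheme \<Rightarrow> 'm set \<Rightarrow> 'm set \<Rightarrow> bool" where
  "is_context C E M \<longleftrightarrow>
     category C \<and> finitely_complete C \<and> has_finite_coproducts C \<and>
     proper_factorization_system C E M \<and>
     (\<forall>X \<in> Obj C. complete_lattice (Sub C M X))"


section \<open>Internal preneighbourhood spaces\<close>

text \<open>The empty meet is included, so a filter always contains the largest element.\<close>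

definition is_filter :: "('a, 'b) gorder_scheme \<Rightarrow> 'a set \<Rightarrow> bool" where
  "is_filter L F \<longleftrightarrow> F \<subseteq> carrier L \<and>
     (\<forall>x \<in> F. \<forall>y \<in> carrier L. x \<sqsubseteq>\<^bsub>L\<^esub> y \<longrightarrow> y \<in> F) \<and>
     (\<forall>A \<subseteq> F. finite A \<longrightarrow> \<Sqinter>\<^bsub>L\<^esub> A \<in> F)"

definition preneighbourhood_system ::
    "('o, 'm, 'r) cat_scheme \<Rightarrow> 'm set \<Rightarrow> 'm set \<Rightarrow> 'o \<Rightarrow> ('m set \<Rightarrow> 'm set set) \<Rightarrow> bool" where
  "preneighbourhood_system C E M X \<mu> \<longleftrightarrow>
     (\<forall>m \<in> carrier (Sub C M X). is_filter (Sub C M X) (\<mu> m)) \<and>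
     (\<forall>m \<in> carrier (Sub C M X). \<forall>n \<in> carrier (Sub C M X).
        m \<sqsubseteq>\<^bsub>Sub C M X\<^esub> n \<longrightarrow> \<mu> n \<subseteq> \<mu> m) \<and>
     \<mu> (sub_bot C E M X) = carrier (Sub C M X) \<and>
     (\<forall>m \<in> carrier (Sub C M X). \<forall>p \<in> \<mu> m. m \<sqsubseteq>\<^bsub>Sub C M X\<^esub> p)"

definition preneighbourhood_space ::
    "('o, 'm, 'r) cat_scheme \<Rightarrow> 'm set \<Rightarrow> 'm set \<Rightarrow> 'o \<Rightarrow> ('m set \<Rightarrow> 'm set set) \<Rightarrow> bool" where
  "preneighbourhood_space C E M X \<mu> \<longleftrightarrow> X \<in> Obj C \<and> preneighbourhood_system C E M X \<mu>"

definition Far ::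
    "('o, 'm, 'r) cat_scheme \<Rightarrow> 'm set \<Rightarrow> 'm set \<Rightarrow> 'o \<Rightarrow> ('m set \<Rightarrow> 'm set set)
       \<Rightarrow> 'm set \<Rightarrow> 'm set set" where
  "Far C E M X \<mu> p =
     {x \<in> carrier (Sub C M X). \<exists>u \<in> \<mu> x. u \<sqinter>\<^bsub>Sub C M X\<^esub> p = sub_bot C E M X}"

definition cl ::
    "('o, 'm, 'r) cat_scheme \<Rightarrow> 'm set \<Rightarrow> 'm set \<Rightarrow> 'o \<Rightarrow> ('m set \<Rightarrow> 'm set set)
       \<Rightarrow> 'm set \<Rightarrow> 'm set" where
  "cl C E M X \<mu> p =
     \<Squnion>\<^bsub>Sub C M X\<^esub> {x \<in> carrier (Sub C M X).
                    \<not> p \<sqsubset>\<^bsub>Sub C M X\<^esub> x \<and> x \<notin> Far C E M X \<mu> p}"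

definition Closed ::
    "('o, 'm, 'r) cat_scheme \<Rightarrow> 'm set \<Rightarrow> 'm set \<Rightarrow> 'o \<Rightarrow> ('m set \<Rightarrow> 'm set set)
       \<Rightarrow> 'm set set" where
  "Closed C E M X \<mu> = {p \<in> carrier (Sub C M X). cl C E M X \<mu> p = p}"

definition cl_hat ::
    "('o, 'm, 'r) cat_scheme \<Rightarrow> 'm set \<Rightarrow> 'm set \<Rightarrow> 'o \<Rightarrow> ('m set \<Rightarrow> 'm set set)
       \<Rightarrow> 'm set \<Rightarrow> 'm set" where
  "cl_hat C E M X \<mu> p =
     \<Sqinter>\<^bsub>Sub C M X\<^esub> {t \<in> Closed C E M X \<mu>. p \<sqsubseteq>\<^bsub>Sub C M X\<^esub> t}"

end

theory Submission
  imports Defs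
begin

text \<open>
  The theorem is a statement about complete lattices. Two facts carry it.

  First, \<open>cl\<close> is extensive and monotone on the lattice of admissible subobjects. It is extensive
  because a nonzero \<open>p\<close> is never far from itself (every \<open>u \<in> \<mu> p\<close> lies above \<open>p\<close>), while everything
  is far from \<open>\<sigma>\<^sub>X\<close>; it is monotone because the set whose join is taken grows with \<open>p\<close>. Hence the
  closed subobjects are stable under arbitrary meets, and \<open>cl_hat\<close> is the idempotent closure
  operator that they generate: \<open>cl_hat p\<close> is the least closed subobject above \<open>p\<close>, and
  \<open>cl p \<sqsubseteq> cl_hat p\<close>.

  Second, image and preimage are adjoint. Both sides of the adjunction say that \<open>f \<cdot> m\<close> factors
  through \<open>k\<close>: for the image this is the diagonal property of the factorization system, for the
  preimage the universal property of the pullback.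

  In the equivalence, (c) is the central condition. Given (c), the preimage of \<open>cl_hat (\<exists>\<^sub>f p)\<close> is a
  closed subobject above \<open>p\<close>, hence above \<open>cl_hat p\<close>, which is (b); and (d) follows because
  \<open>cl p \<sqsubseteq> cl_hat p\<close>. Conversely each of (a), (b) and (d), applied to \<open>p = f\<inverse> t\<close> with \<open>t\<close> closed,
  gives \<open>\<exists>\<^sub>f (cl p) \<sqsubseteq> t\<close>, that is \<open>cl p \<sqsubseteq> p\<close>.

  What remains is to see that the set-valued operations \<open>sub_bot\<close>, \<open>sub_image\<close> and \<open>sub_preimage\<close>
  really yield admissible subobjects, that is, whole equivalence classes of \<open>M\<close>-morphisms.
\<close>

section \<open>Extensive monotone operators and adjunctions\<close>

locale extensive_monotone = complete_lattice L for L :: "'a gorder" (structure) +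
  fixes c :: "'a \<Rightarrow> 'a"
  assumes op_closed: "p \<in> carrier L \<Longrightarrow> c p \<in> carrier L"
    and extensive: "p \<in> carrier L \<Longrightarrow> p \<sqsubseteq> c p"
    and monotone: "\<lbrakk>p \<in> carrier L; q \<in> carrier L; p \<sqsubseteq> q\<rbrakk> \<Longrightarrow> c p \<sqsubseteq> c q"
begin

definition fixed :: "'a set" where
  "fixed = {p \<in> carrier L. c p = p}"

definition hull :: "'a \<Rightarrow> 'a" where
  "hull p = \<Sqinter>{t \<in> fixed. p \<sqsubseteq> t}"

lemma fixedD: "t \<in> fixed \<Longrightarrow> t \<in> carrier L" "t \<in> fixed \<Longrightarrow> c t = t"
  by (auto simp: fixed_def)

lemma fixedI: "\<lbrakk>p \<in> carrier L; c p \<sqsubseteq> p\<rbrakk> \<Longrightarrow> p \<in> fixed"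
  unfolding fixed_def using le_antisym[of "c p" p] extensive op_closed by simp

lemma above_subset: "{t \<in> fixed. p \<sqsubseteq> t} \<subseteq> carrier L"
  using fixedD by auto

lemma hull_closed: "hull p \<in> carrier L"
  unfolding hull_def using above_subset by (rule inf_closed)

lemma hull_extensive: "p \<in> carrier L \<Longrightarrow> p \<sqsubseteq> hull p"
  unfolding hull_def using above_subset by (intro inf_greatest) auto

lemma hull_le_fixed: "\<lbrakk>t \<in> fixed; p \<sqsubseteq> t\<rbrakk> \<Longrightarrow> hull p \<sqsubseteq> t"
  unfolding hull_def using above_subset by (intro inf_lower) auto

lemma hull_fixed: "p \<in> carrier L \<Longrightarrow> hull p \<in> fixed"
proof (rule fixedI[OF hull_closed])
  have "c (hull p) \<sqsubseteq> t" if t: "t \<in> fixed" "p \<sqsubseteq> t" for t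
    using monotone[OF hull_closed fixedD(1)[OF t(1)] hull_le_fixed[OF t]] fixedD(2)[OF t(1)]
    by simp
  then have "c (hull p) \<sqsubseteq> \<Sqinter>{t \<in> fixed. p \<sqsubseteq> t}"
    by (intro inf_greatest above_subset op_closed hull_closed) auto
  then show "c (hull p) \<sqsubseteq> hull p"
    by (simp only: hull_def)
qed

lemma hull_monotone:
  assumes "p \<in> carrier L" "q \<in> carrier L" "p \<sqsubseteq> q"
  shows "hull p \<sqsubseteq> hull q"
  by (intro hull_le_fixed hull_fixed le_trans[OF assms(3) hull_extensive] assms hull_closed)

lemma op_le_hull:
  assumes "p \<in> carrier L"
  shows "c p \<sqsubseteq> hull p"
  using monotone[OF assms hull_closed hull_extensive[OF assms]] fixedD(2)[OF hull_fixed[OF assms]]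
  by simp

end

locale adjunction_of_operators =
  dom: extensive_monotone K c + cod: extensive_monotone L d
  for K :: "'a gorder" and c and L :: "'b gorder" and d +
  fixes i :: "'a \<Rightarrow> 'b" and q :: "'b \<Rightarrow> 'a"
  assumes image_closed: "p \<in> carrier K \<Longrightarrow> i p \<in> carrier L"
    and preimage_closed: "t \<in> carrier L \<Longrightarrow> q t \<in> carrier K"
    and adjoint: "\<lbrakk>p \<in> carrier K; t \<in> carrier L\<rbrakk> \<Longrightarrow> i p \<sqsubseteq>\<^bsub>L\<^esub> t \<longleftrightarrow> p \<sqsubseteq>\<^bsub>K\<^esub> q t"
begin

lemma image_monotone:
  assumes "p \<in> carrier K" "p' \<in> carrier K" "p \<sqsubseteq>\<^bsub>K\<^esub> p'"
  shows "i p \<sqsubseteq>\<^bsub>L\<^esub> i p'"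
proof -
  note ip' = image_closed[OF assms(2)]
  have "p' \<sqsubseteq>\<^bsub>K\<^esub> q (i p')"
    using adjoint[OF assms(2) ip'] ip' by simp
  then have "p \<sqsubseteq>\<^bsub>K\<^esub> q (i p')"
    using dom.le_trans[OF assms(3) _ assms(1,2) preimage_closed[OF ip']] by simp
  then show ?thesis
    using adjoint[OF assms(1) ip'] by simp
qed

lemma counit: "t \<in> carrier L \<Longrightarrow> i (q t) \<sqsubseteq>\<^bsub>L\<^esub> t"
  using adjoint[OF preimage_closed] preimage_closed by simp

text \<open>Every implication with conclusion (c) ends here: by adjointness, fixedness of \<open>q t\<close> can be tested
  on the image side.\<close>

lemma preimage_fixedI:
  assumes "t \<in> cod.fixed" "i (c (q t)) \<sqsubseteq>\<^bsub>L\<^esub> t"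
  shows "q t \<in> dom.fixed"
proof (rule dom.fixedI)
  have t: "t \<in> carrier L"
    using assms(1) by (rule cod.fixedD)
  show qt: "q t \<in> carrier K"
    using t by (rule preimage_closed)
  show "c (q t) \<sqsubseteq>\<^bsub>K\<^esub> q t"
    using assms(2) adjoint[OF dom.op_closed[OF qt] t] by simp
qed

lemma op_continuous_imp_preimage_fixed:
  assumes a: "\<And>p. p \<in> carrier K \<Longrightarrow> i (c p) \<sqsubseteq>\<^bsub>L\<^esub> d (i p)"
    and t: "t \<in> cod.fixed"
  shows "q t \<in> dom.fixed"
proof (rule preimage_fixedI[OF t])
  have tL: "t \<in> carrier L"
    using t by (rule cod.fixedD)
  have qt: "q t \<in> carrier K"
    using tL by (rule preimage_closed)
  have "d (i (q t)) \<sqsubseteq>\<^bsub>L\<^esub> t"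
    using cod.monotone[OF image_closed[OF qt] tL counit[OF tL]] cod.fixedD(2)[OF t] by simp
  with a[OF qt] show "i (c (q t)) \<sqsubseteq>\<^bsub>L\<^esub> t"
    by (rule cod.le_trans) (intro image_closed cod.op_closed dom.op_closed qt tL)+
qed

lemma hull_continuous_iff_preimage_fixed:
  "(\<forall>p \<in> carrier K. i (dom.hull p) \<sqsubseteq>\<^bsub>L\<^esub> cod.hull (i p)) \<longleftrightarrow>
   (\<forall>t \<in> cod.fixed. q t \<in> dom.fixed)"
proof (intro iffI ballI)
  fix t assume b: "\<forall>p \<in> carrier K. i (dom.hull p) \<sqsubseteq>\<^bsub>L\<^esub> cod.hull (i p)" and t: "t \<in> cod.fixed"
  have tL: "t \<in> carrier L"
    using t by (rule cod.fixedD)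
  have qt: "q t \<in> carrier K"
    using tL by (rule preimage_closed)
  have "i (c (q t)) \<sqsubseteq>\<^bsub>L\<^esub> i (dom.hull (q t))"
    by (intro image_monotone dom.op_closed dom.hull_closed dom.op_le_hull qt)
  moreover have "i (dom.hull (q t)) \<sqsubseteq>\<^bsub>L\<^esub> cod.hull (i (q t))"
    using b qt by (rule bspec)
  ultimately have "i (c (q t)) \<sqsubseteq>\<^bsub>L\<^esub> cod.hull (i (q t))"
    by (rule cod.le_trans) (intro image_closed cod.hull_closed dom.op_closed dom.hull_closed qt)+
  moreover have "cod.hull (i (q t)) \<sqsubseteq>\<^bsub>L\<^esub> t"
    using t counit[OF tL] by (rule cod.hull_le_fixed)
  ultimately have "i (c (q t)) \<sqsubseteq>\<^bsub>L\<^esub> t"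
    by (rule cod.le_trans) (intro image_closed cod.hull_closed dom.op_closed qt tL)+
  with t show "q t \<in> dom.fixed"
    by (rule preimage_fixedI)
next
  fix p assume c: "\<forall>t \<in> cod.fixed. q t \<in> dom.fixed" and p: "p \<in> carrier K"
  have "p \<sqsubseteq>\<^bsub>K\<^esub> q (cod.hull (i p))"
    using adjoint[OF p cod.hull_closed] cod.hull_extensive[OF image_closed[OF p]] by simp
  then have "dom.hull p \<sqsubseteq>\<^bsub>K\<^esub> q (cod.hull (i p))"
    using c cod.hull_fixed[OF image_closed[OF p]] by (intro dom.hull_le_fixed) auto
  then show "i (dom.hull p) \<sqsubseteq>\<^bsub>L\<^esub> cod.hull (i p)"
    using adjoint[OF dom.hull_closed cod.hull_closed] by simp
qed

text \<open>From left to right, the content is \<open>i (c p) \<sqsubseteq> cod.hull (i p)\<close>, which continuity of the hulls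
  gives because \<open>c p\<close> lies below \<open>dom.hull p\<close>.\<close>

lemma preimage_fixed_iff_hull_eq:
  "(\<forall>t \<in> cod.fixed. q t \<in> dom.fixed) \<longleftrightarrow>
   (\<forall>p \<in> carrier K. cod.hull (i p) = cod.hull (i (c p)))"
proof (intro iffI ballI)
  fix p assume "\<forall>t \<in> cod.fixed. q t \<in> dom.fixed" and p: "p \<in> carrier K"
  then have b: "i (dom.hull p) \<sqsubseteq>\<^bsub>L\<^esub> cod.hull (i p)"
    using hull_continuous_iff_preimage_fixed by blast
  have cp: "c p \<in> carrier K"
    using p by (rule dom.op_closed)
  have 1: "i (c p) \<sqsubseteq>\<^bsub>L\<^esub> i (dom.hull p)"
    by (intro image_monotone cp dom.hull_closed dom.op_le_hull p)
  have "i (c p) \<sqsubseteq>\<^bsub>L\<^esub> cod.hull (i p)"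
    using 1 b by (rule cod.le_trans) (intro image_closed cp dom.hull_closed cod.hull_closed)+
  then have "cod.hull (i (c p)) \<sqsubseteq>\<^bsub>L\<^esub> cod.hull (i p)"
    by (intro cod.hull_le_fixed cod.hull_fixed image_closed p)
  moreover have "cod.hull (i p) \<sqsubseteq>\<^bsub>L\<^esub> cod.hull (i (c p))"
    by (intro cod.hull_monotone image_monotone image_closed dom.extensive p cp)
  ultimately show "cod.hull (i p) = cod.hull (i (c p))"
    by (intro cod.le_antisym cod.hull_closed)
next
  fix t assume d: "\<forall>p \<in> carrier K. cod.hull (i p) = cod.hull (i (c p))" and t: "t \<in> cod.fixed"
  have tL: "t \<in> carrier L"
    using t by (rule cod.fixedD)
  have qt: "q t \<in> carrier K"
    using tL by (rule preimage_closed)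
  have icq: "i (c (q t)) \<in> carrier L"
    by (intro image_closed dom.op_closed qt)
  have "cod.hull (i (q t)) \<sqsubseteq>\<^bsub>L\<^esub> t"
    using t counit[OF tL] by (rule cod.hull_le_fixed)
  then have "cod.hull (i (c (q t))) \<sqsubseteq>\<^bsub>L\<^esub> t"
    using d qt by simp
  then show "q t \<in> dom.fixed"
    using t cod.le_trans[OF cod.hull_extensive[OF icq] _ icq cod.hull_closed tL]
    by (intro preimage_fixedI)
qed

end

section \<open>Morphisms and pullbacks\<close>

lemma HomI: "\<lbrakk>f \<in> Arr C; Dom C f = X; Cod C f = Y\<rbrakk> \<Longrightarrow> f \<in> Hom C X Y"
  by (simp add: Hom_def)

lemma HomD:
  assumes "f \<in> Hom C X Y"
  shows "f \<in> Arr C" "Dom C f = X" "Cod C f = Y"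
  using assms by (auto simp: Hom_def)

lemma mono_arr: "is_mono C m \<Longrightarrow> m \<in> Arr C"
  unfolding is_mono_def by (rule conjunct1)

lemma mono_cancel:
  "\<lbrakk>is_mono C m; g \<in> Hom C T (Dom C m); h \<in> Hom C T (Dom C m); m \<cdot>\<^bsub>C\<^esub> g = m \<cdot>\<^bsub>C\<^esub> h\<rbrakk> \<Longrightarrow> g = h"
  by (simp add: is_mono_def)

lemma epi_cancel:
  "\<lbrakk>is_epi C e; g \<in> Hom C (Cod C e) T; h \<in> Hom C (Cod C e) T; g \<cdot>\<^bsub>C\<^esub> e = h \<cdot>\<^bsub>C\<^esub> e\<rbrakk> \<Longrightarrow> g = h"
  by (simp add: is_epi_def)

text \<open>The shape of a cospan \<open>0 \<rightarrow> 2 \<leftarrow> 1\<close>: the arrows 0, 1, 2 are the identities of the objects of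
  the same name, and 3 and 4 are the two legs.\<close>

definition cospan :: "(nat, nat) cat" where
  "cospan =
    \<lparr>Obj = {0, 1, 2}, Arr = {0, 1, 2, 3, 4},
     Dom = (\<lambda>u. if u = 3 then 0 else if u = 4 then 1 else u),
     Cod = (\<lambda>u. if u = 3 \<or> u = 4 then 2 else u),
     Id = (\<lambda>j. j), Comp = (\<lambda>v u. if u < 3 then v else u)\<rparr>"

lemma category_cospan: "category cospan"
  by unfold_locales (auto simp: cospan_def Hom_def split: if_splits)

context category
begin

lemma arr_Hom: "f \<in> Arr C \<Longrightarrow> f \<in> Hom C (Dom C f) (Cod C f)"
  by (rule HomI) auto

lemma mono_le_refl:
  assumes "m \<in> Arr C"
  shows "mono_le C m m"
  unfolding mono_le_def
  using Id_closed[OF Dom_closed[OF assms]] Comp_Id[OF arr_Hom[OF assms]] by metis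

lemma mono_le_trans:
  assumes "mono_le C l m" "mono_le C m n" "n \<in> Arr C"
  shows "mono_le C l n"
proof -
  obtain g h where g: "g \<in> Hom C (Dom C l) (Dom C m)" "l = m \<cdot> g"
    and h: "h \<in> Hom C (Dom C m) (Dom C n)" "m = n \<cdot> h"
    using assms unfolding mono_le_def by blast
  have "l = n \<cdot> (h \<cdot> g)"
    using Comp_assoc[OF g(1) h(1) arr_Hom[OF assms(3)]] g(2) h(2) by simp
  then show ?thesis
    unfolding mono_le_def using Comp_closed[OF g(1) h(1)] by blast
qed

text \<open>Between monomorphisms the comparison morphism is unique, so mutual comparisons are inverse
  to each other.\<close>

lemma mono_le_iso:
  assumes "is_mono C m" "is_mono C n" "mono_le C m n" "mono_le C n m"
  obtains g where "g \<in> Hom C (Dom C m) (Dom C n)" "is_iso C g" "m = n \<cdot> g"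
proof -
  obtain g h where g: "g \<in> Hom C (Dom C m) (Dom C n)" "m = n \<cdot> g"
    and h: "h \<in> Hom C (Dom C n) (Dom C m)" "n = m \<cdot> h"
    using assms(3,4) unfolding mono_le_def by blast
  have m: "m \<in> Arr C" and n: "n \<in> Arr C"
    using assms(1,2) by (simp_all add: mono_arr)
  have "m \<cdot> (h \<cdot> g) = m \<cdot> Id C (Dom C m)"
    using Comp_assoc[OF g(1) h(1) arr_Hom[OF m]] g(2)[symmetric] h(2)[symmetric] Comp_Id[OF arr_Hom[OF m]] by simp
  then have hg: "h \<cdot> g = Id C (Dom C m)"
    by (rule mono_cancel[OF assms(1) Comp_closed[OF g(1) h(1)] Id_closed[OF Dom_closed[OF m]]])
  have "n \<cdot> (g \<cdot> h) = n \<cdot> Id C (Dom C n)"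
    using Comp_assoc[OF h(1) g(1) arr_Hom[OF n]] g(2)[symmetric] h(2)[symmetric] Comp_Id[OF arr_Hom[OF n]] by simp
  then have gh: "g \<cdot> h = Id C (Dom C n)"
    by (rule mono_cancel[OF assms(2) Comp_closed[OF h(1) g(1)] Id_closed[OF Dom_closed[OF n]]])
  have "is_iso C g"
    unfolding is_iso_def using hg gh h(1) HomD[OF g(1)] by auto
  then show ?thesis
    using that g by blast
qed

lemma pullbackD:
  assumes "is_pullback C f n m g"
  shows "m \<in> Hom C (Dom C m) (Dom C f)" "g \<in> Hom C (Dom C m) (Dom C n)" "f \<cdot> m = n \<cdot> g"
  using assms unfolding is_pullback_def by blast+

lemma pullback_factor:
  assumes "is_pullback C f n m g"
    and "a \<in> Hom C T (Dom C f)" "b \<in> Hom C T (Dom C n)" "f \<cdot> a = n \<cdot> b"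
  obtains h where "h \<in> Hom C T (Dom C m)" "m \<cdot> h = a" "g \<cdot> h = b"
proof -
  have "\<exists>!h. h \<in> Hom C T (Dom C m) \<and> m \<cdot> h = a \<and> g \<cdot> h = b"
    using assms unfolding is_pullback_def by blast
  then show ?thesis
    using that by blast
qed

lemma pullback_unique:
  assumes "is_pullback C f n m g"
    and "h \<in> Hom C T (Dom C m)" "h' \<in> Hom C T (Dom C m)" "m \<cdot> h = m \<cdot> h'" "g \<cdot> h = g \<cdot> h'"
  shows "h = h'"
proof -
  note pb = pullbackD[OF assms(1)]
  have f: "f \<in> Hom C (Dom C f) (Cod C f)" and n: "n \<in> Hom C (Dom C n) (Cod C f)"
    using assms(1) arr_Hom unfolding is_pullback_def by metis+
  have "f \<cdot> (m \<cdot> h) = n \<cdot> (g \<cdot> h)"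
    using Comp_assoc[OF assms(2) pb(1) f] Comp_assoc[OF assms(2) pb(2) n] pb(3) by simp
  then have "\<exists>!k. k \<in> Hom C T (Dom C m) \<and> m \<cdot> k = m \<cdot> h \<and> g \<cdot> k = g \<cdot> h"
    using assms(1) Comp_closed[OF assms(2) pb(1)] Comp_closed[OF assms(2) pb(2)]
    unfolding is_pullback_def by blast
  then show ?thesis
    using assms(2-5) by (auto elim!: ex1E)
qed

text \<open>When \<open>m\<close> and \<open>n\<close> are monomorphisms, the uniqueness clause and the second triangle of the
  universal property come for free.\<close>

lemma pullback_monoI:
  assumes f: "f \<in> Arr C" and fn: "Cod C f = Cod C n" and n: "is_mono C n" and m: "is_mono C m"
    and "Cod C m = Dom C f" and g: "g \<in> Hom C (Dom C m) (Dom C n)" and fm: "f \<cdot> m = n \<cdot> g"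
    and ex: "\<And>T a b. \<lbrakk>a \<in> Hom C T (Dom C f); b \<in> Hom C T (Dom C n); f \<cdot> a = n \<cdot> b\<rbrakk>
               \<Longrightarrow> \<exists>h \<in> Hom C T (Dom C m). m \<cdot> h = a"
  shows "is_pullback C f n m g"
  unfolding is_pullback_def
proof (intro conjI allI impI)
  have nA: "n \<in> Arr C" and mA: "m \<in> Arr C"
    using n m by (simp_all add: mono_arr)
  show "f \<in> Arr C" "n \<in> Arr C" "Cod C f = Cod C n" "g \<in> Hom C (Dom C m) (Dom C n)" "f \<cdot> m = n \<cdot> g"
    using f nA fn g fm by simp_all
  show mH: "m \<in> Hom C (Dom C m) (Dom C f)"
    using arr_Hom[OF mA] assms(5) by simp
  have fH: "f \<in> Hom C (Dom C f) (Cod C f)" and nH: "n \<in> Hom C (Dom C n) (Cod C f)"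
    using arr_Hom[OF f] arr_Hom[OF nA] fn by simp_all
  fix T a b
  assume a: "a \<in> Hom C T (Dom C f)" and b: "b \<in> Hom C T (Dom C n)" and ab: "f \<cdot> a = n \<cdot> b"
  obtain h where h: "h \<in> Hom C T (Dom C m)" "m \<cdot> h = a"
    using ex[OF a b ab] by blast
  have "n \<cdot> (g \<cdot> h) = n \<cdot> b"
    using Comp_assoc[OF h(1) mH fH] Comp_assoc[OF h(1) g nH] unfolding h(2) fm ab by simp
  then have gh: "g \<cdot> h = b"
    by (rule mono_cancel[OF n Comp_closed[OF h(1) g] b])
  show "\<exists>!h. h \<in> Hom C T (Dom C m) \<and> m \<cdot> h = a \<and> g \<cdot> h = b"
  proof (rule ex1I[of _ h])
    fix h' assume h': "h' \<in> Hom C T (Dom C m) \<and> m \<cdot> h' = a \<and> g \<cdot> h' = b"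
    then have "h' \<in> Hom C T (Dom C m)" "m \<cdot> h' = m \<cdot> h"
      using h(2) by simp_all
    then show "h' = h"
      by (rule mono_cancel[OF m _ h(1)])
  qed (use h gh in simp)
qed

lemma pullback_exists:
  assumes "finitely_complete C" "f \<in> Arr C" "n \<in> Arr C" "Cod C f = Cod C n"
  shows "\<exists>m g. is_pullback C f n m g"
proof -
  define F where "F = (\<lambda>j::nat. if j = 0 then Dom C f else if j = 1 then Dom C n else Cod C f)"
  define G where "G = (\<lambda>u::nat. if u = 3 then f else if u = 4 then n else Id C (F u))"
  have fH: "f \<in> Hom C (Dom C f) (Cod C f)" and nH: "n \<in> Hom C (Dom C n) (Cod C f)"
    using arr_Hom assms by metis+
  have FO: "F j \<in> Obj C" for j
    using assms Dom_closed Cod_closed by (simp add: F_def)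
  have IdId: "Id C A \<cdot> Id C A = Id C A" if "A \<in> Obj C" for A
    using Comp_Id Id_closed that by blast
  have diagram: "is_diagram cospan C F G"
    using FO fH nH Id_closed[OF FO] IdId Comp_Id[OF fH] Comp_Id[OF nH] Id_Comp[OF fH] Id_Comp[OF nH]
      assms Dom_closed Cod_closed
    by (auto simp: is_diagram_def cospan_def G_def F_def Id_closed)
  have cone: "is_cone cospan C F G T \<tau> \<longleftrightarrow>
      T \<in> Obj C \<and> \<tau> 0 \<in> Hom C T (Dom C f) \<and> \<tau> 1 \<in> Hom C T (Dom C n) \<and>
      \<tau> 2 = f \<cdot> \<tau> 0 \<and> f \<cdot> \<tau> 0 = n \<cdot> \<tau> 1" for T \<tau>
    using Id_Comp[of "\<tau> 0"] Id_Comp[of "\<tau> 1"] Id_Comp[of "\<tau> 2"]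
      Comp_closed[of "\<tau> 0" T, OF _ fH] Comp_closed[of "\<tau> 1" T, OF _ nH]
    by (auto simp: is_cone_def cospan_def G_def F_def)
  have "\<exists>L \<pi>. is_limit cospan C F G L \<pi>"
    using assms(1) category_cospan diagram unfolding finitely_complete_def
    by (auto simp: cospan_def)
  then obtain L \<pi> where lim: "is_limit cospan C F G L \<pi>"
    by blast
  then have \<pi>: "L \<in> Obj C" "\<pi> 0 \<in> Hom C L (Dom C f)" "\<pi> 1 \<in> Hom C L (Dom C n)"
    "\<pi> 2 = f \<cdot> \<pi> 0" "f \<cdot> \<pi> 0 = n \<cdot> \<pi> 1"
    unfolding is_limit_def cone by auto
  have "is_pullback C f n (\<pi> 0) (\<pi> 1)"
    unfolding is_pullback_def HomD(2)[OF \<pi>(2)]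
  proof (intro conjI allI impI)
    fix T a b
    assume a: "a \<in> Hom C T (Dom C f)" and b: "b \<in> Hom C T (Dom C n)" and ab: "f \<cdot> a = n \<cdot> b"
    define \<tau> where "\<tau> = (\<lambda>j::nat. if j = 0 then a else if j = 1 then b else f \<cdot> a)"
    have "T \<in> Obj C"
      using HomD[OF a] Dom_closed by blast
    then have "is_cone cospan C F G T \<tau>"
      unfolding cone using a b ab by (simp add: \<tau>_def)
    then have "\<exists>!h. h \<in> Hom C T L \<and> (\<forall>j \<in> Obj cospan. \<pi> j \<cdot> h = \<tau> j)"
      using lim unfolding is_limit_def by blast
    moreover have "(\<forall>j \<in> Obj cospan. \<pi> j \<cdot> h = \<tau> j) \<longleftrightarrow> \<pi> 0 \<cdot> h = a \<and> \<pi> 1 \<cdot> h = b"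
      if "h \<in> Hom C T L" for h
      using Comp_assoc[OF that \<pi>(2) fH] \<pi>(4) by (auto simp: cospan_def \<tau>_def)
    ultimately show "\<exists>!h. h \<in> Hom C T L \<and> \<pi> 0 \<cdot> h = a \<and> \<pi> 1 \<cdot> h = b"
      by (metis (no_types, lifting))
  qed (use assms \<pi> in auto)
  then show ?thesis
    by blast
qed

end

section \<open>The lattice of admissible subobjects\<close>

locale proper_factorization = category C for C :: "('o, 'm) cat" (structure) +
  fixes E M :: "'m set"
  assumes proper: "proper_factorization_system C E M"
begin

lemma
  shows M_mono: "m \<in> M \<Longrightarrow> is_mono C m"
    and E_epi: "e \<in> E \<Longrightarrow> is_epi C e"
    and M_arr: "m \<in> M \<Longrightarrow> m \<in> Arr C"
    and E_arr: "e \<in> E \<Longrightarrow> e \<in> Arr C"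
    and iso_E: "is_iso C g \<Longrightarrow> g \<in> E"
    and iso_M: "is_iso C g \<Longrightarrow> g \<in> M"
    and E_comp: "\<lbrakk>e \<in> E; e' \<in> E; Cod C e = Dom C e'\<rbrakk> \<Longrightarrow> e' \<cdot> e \<in> E"
    and M_comp: "\<lbrakk>m \<in> M; m' \<in> M; Cod C m = Dom C m'\<rbrakk> \<Longrightarrow> m' \<cdot> m \<in> M"
    and factorization_exists: "h \<in> Arr C \<Longrightarrow> \<exists>e m. is_factorization C E M h e m"
  using proper unfolding proper_factorization_system_def factorization_system_def by blast+

lemma diagonal:
  assumes "e \<in> E" "m \<in> M" "u \<in> Hom C (Dom C e) (Dom C m)" "v \<in> Hom C (Cod C e) (Cod C m)"
    and "m \<cdot> u = v \<cdot> e"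
  obtains d where "d \<in> Hom C (Cod C e) (Dom C m)" "d \<cdot> e = u" "m \<cdot> d = v"
  using assms proper unfolding proper_factorization_system_def factorization_system_def by metis

lemma factorizationD:
  assumes "is_factorization C E M h e n"
  shows "e \<in> E" "n \<in> M" "e \<in> Hom C (Dom C h) (Dom C n)" "n \<in> Hom C (Dom C n) (Cod C h)"
    "h = n \<cdot> e"
proof -
  show e: "e \<in> E" and n: "n \<in> M" and h: "h = n \<cdot> e"
    using assms unfolding is_factorization_def by auto
  have e1: "e \<in> Hom C (Dom C e) (Dom C n)"
    using arr_Hom[OF E_arr[OF e]] assms unfolding is_factorization_def by simp
  then have "h \<in> Hom C (Dom C e) (Cod C n)"
    unfolding h using arr_Hom[OF M_arr[OF n]] by (rule Comp_closed)
  then show "e \<in> Hom C (Dom C h) (Dom C n)" "n \<in> Hom C (Dom C n) (Cod C h)"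
    using e1 arr_Hom[OF M_arr[OF n]] HomD by metis+
qed

text \<open>The \<open>M\<close>-part of \<open>h\<close> is the least \<open>M\<close>-morphism through which \<open>h\<close> factors, by the diagonal
  property.\<close>

lemma factorization_le_iff:
  assumes fact: "is_factorization C E M h e n" and k: "k \<in> M" "Cod C k = Cod C h"
  shows "mono_le C n k \<longleftrightarrow> (\<exists>b \<in> Hom C (Dom C h) (Dom C k). h = k \<cdot> b)"
proof
  note F = factorizationD[OF fact]
  have kH: "k \<in> Hom C (Dom C k) (Cod C h)"
    using arr_Hom[OF M_arr[OF k(1)]] k(2) by simp
  {
    assume "mono_le C n k"
    then obtain g where g: "g \<in> Hom C (Dom C n) (Dom C k)" "n = k \<cdot> g"
      unfolding mono_le_def by blast
    have "h = k \<cdot> (g \<cdot> e)"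
      using Comp_assoc[OF F(3) g(1) kH] F(5) g(2) by simp
    then show "\<exists>b \<in> Hom C (Dom C h) (Dom C k). h = k \<cdot> b"
      using Comp_closed[OF F(3) g(1)] by blast
  next
    assume "\<exists>b \<in> Hom C (Dom C h) (Dom C k). h = k \<cdot> b"
    then obtain b where b: "b \<in> Hom C (Dom C h) (Dom C k)" "k \<cdot> b = n \<cdot> e"
      using F(5) by metis
    have "b \<in> Hom C (Dom C e) (Dom C k)" "n \<in> Hom C (Cod C e) (Cod C k)"
      using b(1) F(4) k(2) HomD[OF F(3)] by simp_all
    then obtain d where "d \<in> Hom C (Cod C e) (Dom C k)" "k \<cdot> d = n"
      using diagonal[OF F(1) k(1) _ _ b(2)] by blast
    then show "mono_le C n k"
      unfolding mono_le_def using HomD[OF F(3)] by auto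
  }
qed

lemma factorization_equiv:
  assumes fact: "is_factorization C E M h e n" and n': "n' \<in> M" "mono_le C n n'" "mono_le C n' n"
  shows "\<exists>e'. is_factorization C E M h e' n'"
proof -
  note F = factorizationD[OF fact]
  obtain g where g: "g \<in> Hom C (Dom C n) (Dom C n')" "is_iso C g" "n = n' \<cdot> g"
    using mono_le_iso[OF M_mono[OF F(2)] M_mono[OF n'(1)] n'(2,3)] by blast
  have "g \<cdot> e \<in> E"
    using E_comp[OF F(1) iso_E[OF g(2)]] HomD[OF F(3)] HomD[OF g(1)] by simp
  moreover have "h = n' \<cdot> (g \<cdot> e)"
    using Comp_assoc[OF F(3) g(1) arr_Hom[OF M_arr[OF n'(1)]]] F(5) g(3) by simp
  ultimately show ?thesis
    unfolding is_factorization_def using n'(1) HomD[OF Comp_closed[OF F(3) g(1)]] by auto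
qed

text \<open>The \<open>E\<close>-part of \<open>m\<close> is invertible: the diagonal property and the universal property of the
  pullback together provide a retraction of it, and it is an epimorphism.\<close>

lemma pullback_in_M:
  assumes pb: "is_pullback C f n m g" and n: "n \<in> M"
  shows "m \<in> M"
proof -
  note P = pullbackD[OF pb]
  have fH: "f \<in> Hom C (Dom C f) (Cod C n)"
    using pb arr_Hom unfolding is_pullback_def by metis
  obtain e m' where fact: "is_factorization C E M m e m'"
    using factorization_exists HomD[OF P(1)] by blast
  note F = factorizationD[OF fact]
  have m'H: "m' \<in> Hom C (Dom C m') (Dom C f)"
    using F(4) HomD[OF P(1)] by simp
  have codE: "Cod C e = Dom C m'" and domE: "Dom C e = Dom C m"
    using HomD[OF F(3)] by auto
  have fm': "f \<cdot> m' \<in> Hom C (Cod C e) (Cod C n)"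
    using Comp_closed[OF m'H fH] codE by simp
  have "n \<cdot> g = (f \<cdot> m') \<cdot> e"
    using Comp_assoc[OF F(3) m'H fH] F(5) P(3) by simp
  then obtain d where d: "d \<in> Hom C (Cod C e) (Dom C n)" "d \<cdot> e = g" "n \<cdot> d = f \<cdot> m'"
    using diagonal[OF F(1) n _ fm'] P(2) domE by metis
  have dH: "d \<in> Hom C (Dom C m') (Dom C n)"
    using d(1) codE by simp
  obtain h where h: "h \<in> Hom C (Dom C m') (Dom C m)" "m \<cdot> h = m'" "g \<cdot> h = d"
    using pullback_factor[OF pb m'H dH d(3)[symmetric]] by blast
  have mA: "m \<in> Arr C"
    using HomD[OF P(1)] by simp
  have he: "h \<cdot> e = Id C (Dom C m)"
  proof (rule pullback_unique[OF pb])
    show "h \<cdot> e \<in> Hom C (Dom C m) (Dom C m)"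
      by (rule Comp_closed[OF F(3) h(1)])
    show "Id C (Dom C m) \<in> Hom C (Dom C m) (Dom C m)"
      by (rule Id_closed[OF Dom_closed[OF mA]])
    show "m \<cdot> (h \<cdot> e) = m \<cdot> Id C (Dom C m)"
      using Comp_assoc[OF F(3) h(1) P(1)] h(2) F(5)[symmetric] Comp_Id[OF P(1)] by simp
    show "g \<cdot> (h \<cdot> e) = g \<cdot> Id C (Dom C m)"
      using Comp_assoc[OF F(3) h(1) P(2)] h(3) d(2) Comp_Id[OF P(2)] by simp
  qed
  have m'O: "Dom C m' \<in> Obj C"
    using HomD[OF m'H] Dom_closed by blast
  have "(e \<cdot> h) \<cdot> e = Id C (Dom C m') \<cdot> e"
    using Comp_assoc[OF F(3) h(1) F(3)] he Comp_Id[OF F(3)] Id_Comp[OF F(3)] by simp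
  then have eh: "e \<cdot> h = Id C (Dom C m')"
    using epi_cancel[OF E_epi[OF F(1)]] Comp_closed[OF h(1) F(3)] Id_closed[OF m'O] codE by metis
  have "is_iso C e"
    unfolding is_iso_def codE domE using E_arr[OF F(1)] h(1) he eh by blast
  then show "m \<in> M"
    using M_comp[OF iso_M F(2) codE] F(5) by simp
qed

definition subobjects :: "'o \<Rightarrow> 'm set" where
  "subobjects X = {m \<in> M. Cod C m = X}"

lemma subobjectsD: "m \<in> subobjects X \<Longrightarrow> m \<in> M" "m \<in> subobjects X \<Longrightarrow> Cod C m = X"
  by (auto simp: subobjects_def)

lemma carrier_Sub: "carrier (Sub C M X) = subobjects X // mono_equiv C M X"
  by (simp add: Sub_def subobjects_def)

lemma equiv_mono_equiv: "equiv (subobjects X) (mono_equiv C M X)"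
proof (rule equivI)
  show "refl_on (subobjects X) (mono_equiv C M X)"
    using mono_le_refl[OF M_arr] by (auto simp: refl_on_def mono_equiv_def subobjects_def)
  show "sym (mono_equiv C M X)"
    by (auto simp: sym_def mono_equiv_def)
  show "trans (mono_equiv C M X)"
    using mono_le_trans[OF _ _ M_arr] unfolding trans_def mono_equiv_def by blast
qed (auto simp: mono_equiv_def subobjects_def)

lemma carrier_SubD:
  assumes "p \<in> carrier (Sub C M X)"
  shows "p \<noteq> {}" "m \<in> p \<Longrightarrow> m \<in> subobjects X"
    "\<lbrakk>m \<in> p; n \<in> p\<rbrakk> \<Longrightarrow> mono_le C m n"
proof -
  have p: "p \<in> subobjects X // mono_equiv C M X"
    using assms by (simp add: carrier_Sub)
  show "p \<noteq> {}"
    using in_quotient_imp_non_empty[OF equiv_mono_equiv p] .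
  show "m \<in> subobjects X" if "m \<in> p"
    using in_quotient_imp_subset[OF equiv_mono_equiv p] that by blast
  show "mono_le C m n" if "m \<in> p" "n \<in> p"
    using in_quotient_imp_in_rel[OF equiv_mono_equiv p, of m n] that
    by (simp add: mono_equiv_def)
qed

lemma carrier_SubI:
  assumes ne: "S \<noteq> {}" and sub: "\<And>m. m \<in> S \<Longrightarrow> m \<in> subobjects X"
    and le: "\<And>m n. \<lbrakk>m \<in> S; n \<in> S\<rbrakk> \<Longrightarrow> mono_le C m n"
    and closed: "\<And>m n. \<lbrakk>m \<in> S; n \<in> subobjects X; mono_le C m n; mono_le C n m\<rbrakk> \<Longrightarrow> n \<in> S"
  shows "S \<in> carrier (Sub C M X)"
proof -
  obtain m where m: "m \<in> S"
    using ne by blast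
  have "S = mono_equiv C M X `` {m}"
  proof (intro Set.set_eqI iffI)
    fix n assume n: "n \<in> S"
    then show "n \<in> mono_equiv C M X `` {m}"
      using m le[OF m n] le[OF n m] sub[OF m] sub[OF n]
      by (simp add: mono_equiv_def subobjects_def)
  next
    fix n assume "n \<in> mono_equiv C M X `` {m}"
    then show "n \<in> S"
      using closed[OF m] by (simp add: mono_equiv_def subobjects_def)
  qed
  then show ?thesis
    unfolding carrier_Sub using sub[OF m] by (metis quotientI)
qed

lemma le_Sub_iff:
  assumes "p \<in> carrier (Sub C M X)" "q \<in> carrier (Sub C M X)" "m \<in> p" "n \<in> q"
  shows "p \<sqsubseteq>\<^bsub>Sub C M X\<^esub> q \<longleftrightarrow> mono_le C m n"
proof
  assume "p \<sqsubseteq>\<^bsub>Sub C M X\<^esub> q"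
  then obtain m' n' where mn': "m' \<in> p" "n' \<in> q" "mono_le C m' n'"
    by (auto simp: Sub_def)
  have n'A: "n' \<in> Arr C" and nA: "n \<in> Arr C"
    using carrier_SubD(2)[OF assms(2)] mn' assms(4) subobjectsD(1) M_arr by blast+
  have "mono_le C m n'"
    using mono_le_trans[OF carrier_SubD(3)[OF assms(1) assms(3) mn'(1)] mn'(3) n'A] .
  then show "mono_le C m n"
    using mono_le_trans[OF _ carrier_SubD(3)[OF assms(2) mn'(2) assms(4)] nA] by blast
qed (use assms in \<open>auto simp: Sub_def\<close>)

text \<open>The morphism from an initial object factors through every \<open>M\<close>-morphism into \<open>X\<close>, so its
  \<open>M\<close>-part is least by \<open>factorization_le_iff\<close>. For the same reason the choice of the initial object
  does not matter.\<close>

lemma initial_factor_le: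
  assumes I: "is_initial C I" "i \<in> Hom C I X" "is_factorization C E M i e m"
    and n: "n \<in> subobjects X"
  shows "mono_le C m n"
proof -
  note n = subobjectsD[OF n]
  have XO: "X \<in> Obj C" and nO: "Dom C n \<in> Obj C"
    using HomD[OF I(2)] Cod_closed M_arr[OF n(1)] Dom_closed by auto
  obtain u where u: "u \<in> Hom C I (Dom C n)"
    using I(1) nO unfolding is_initial_def by blast
  have "n \<cdot> u \<in> Hom C I X"
    using Comp_closed[OF u arr_Hom[OF M_arr[OF n(1)]]] n(2) by simp
  then have "i = n \<cdot> u"
    using I(1,2) XO unfolding is_initial_def by blast
  then show ?thesis
    using factorization_le_iff[OF I(3) n(1)] n(2) u HomD[OF I(2)] by auto
qed

lemma sub_bot_in_carrier:
  assumes "has_finite_coproducts C" and X: "X \<in> Obj C"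
  shows "sub_bot C E M X \<in> carrier (Sub C M X)"
proof (rule carrier_SubI)
  \<comment> \<open>An initial object is a coproduct of the empty family.\<close>
  obtain I \<iota> where "is_coproduct C ({} :: nat set) (\<lambda>_. X) I \<iota>"
    using assms(1) unfolding has_finite_coproducts_def by blast
  then have I: "is_initial C I"
    unfolding is_initial_def is_coproduct_def by simp
  then obtain i where i: "i \<in> Hom C I X"
    using X unfolding is_initial_def by blast
  then obtain e m where "is_factorization C E M i e m"
    using factorization_exists HomD by metis
  then show "sub_bot C E M X \<noteq> {}"
    unfolding sub_bot_def using I i by blast
next
  fix m assume "m \<in> sub_bot C E M X"
  then obtain I i e where I: "is_initial C I" "i \<in> Hom C I X" "is_factorization C E M i e m"
    unfolding sub_bot_def by blast
  show m: "m \<in> subobjects X"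
    using factorizationD[OF I(3)] HomD[OF I(2)] HomD[of m] by (auto simp: subobjects_def)
  {
    fix n assume "n \<in> sub_bot C E M X"
    then obtain J j d where J: "j \<in> Hom C J X" "is_factorization C E M j d n"
      unfolding sub_bot_def by blast
    then have "n \<in> subobjects X"
      using factorizationD[OF J(2)] HomD[OF J(1)] HomD[of n] by (auto simp: subobjects_def)
    then show "mono_le C m n"
      by (rule initial_factor_le[OF I])
  next
    fix n assume "n \<in> subobjects X" "mono_le C m n" "mono_le C n m"
    then show "n \<in> sub_bot C E M X"
      using factorization_equiv[OF I(3)] I(1,2) subobjectsD(1) unfolding sub_bot_def by blast
  }
qed

lemma sub_bot_least:
  assumes "has_finite_coproducts C" "X \<in> Obj C" and p: "p \<in> carrier (Sub C M X)"
  shows "sub_bot C E M X \<sqsubseteq>\<^bsub>Sub C M X\<^esub> p"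
proof -
  have b: "sub_bot C E M X \<in> carrier (Sub C M X)"
    using assms(1,2) by (rule sub_bot_in_carrier)
  obtain m n where m: "m \<in> sub_bot C E M X" and n: "n \<in> p"
    using carrier_SubD(1)[OF b] carrier_SubD(1)[OF p] by blast
  have "mono_le C m n"
    using m initial_factor_le carrier_SubD(2)[OF p n] unfolding sub_bot_def by blast
  then show ?thesis
    using le_Sub_iff[OF b p m n] by simp
qed

lemma image_le_iff:
  assumes f: "f \<in> Hom C X Y" and m: "m \<in> subobjects X" and k: "k \<in> subobjects Y"
    and fact: "is_factorization C E M (f \<cdot> m) e n"
  shows "mono_le C n k \<longleftrightarrow> (\<exists>b \<in> Hom C (Dom C m) (Dom C k). f \<cdot> m = k \<cdot> b)"
proof -
  have "m \<in> Hom C (Dom C m) X"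
    using arr_Hom[OF M_arr] subobjectsD[OF m] by metis
  note fm = HomD[OF Comp_closed[OF this f]]
  show ?thesis
    using factorization_le_iff[OF fact] subobjectsD[OF k] fm by simp
qed

lemma le_preimage_iff:
  assumes m: "m \<in> subobjects X" and k: "k \<in> subobjects Y" and pb: "is_pullback C f k r g"
    and f: "f \<in> Hom C X Y"
  shows "mono_le C m r \<longleftrightarrow> (\<exists>b \<in> Hom C (Dom C m) (Dom C k). f \<cdot> m = k \<cdot> b)"
proof
  note P = pullbackD[OF pb]
  have kH: "k \<in> Hom C (Dom C k) Y" and mH: "m \<in> Hom C (Dom C m) (Dom C f)"
    and rH: "r \<in> Hom C (Dom C r) X"
    using arr_Hom[OF M_arr] subobjectsD[OF k] subobjectsD[OF m] P(1) HomD[OF f] by metis+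
  {
    assume "mono_le C m r"
    then obtain h where h: "h \<in> Hom C (Dom C m) (Dom C r)" "m = r \<cdot> h"
      unfolding mono_le_def by blast
    have "f \<cdot> m = k \<cdot> (g \<cdot> h)"
      using Comp_assoc[OF h(1) rH f] Comp_assoc[OF h(1) P(2) kH] P(3) h(2) by simp
    then show "\<exists>b \<in> Hom C (Dom C m) (Dom C k). f \<cdot> m = k \<cdot> b"
      using Comp_closed[OF h(1) P(2)] by blast
  next
    assume "\<exists>b \<in> Hom C (Dom C m) (Dom C k). f \<cdot> m = k \<cdot> b"
    then obtain b where "b \<in> Hom C (Dom C m) (Dom C k)" "f \<cdot> m = k \<cdot> b"
      by blast
    then obtain h where "h \<in> Hom C (Dom C m) (Dom C r)" "r \<cdot> h = m"
      using pullback_factor[OF pb mH] by metis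
    then show "mono_le C m r"
      unfolding mono_le_def by blast
  }
qed

lemma factor_through_mono:
  assumes k: "k \<in> subobjects Y" and k': "k' \<in> subobjects Y" and le: "mono_le C k k'"
    and b: "b \<in> Hom C T (Dom C k)"
  shows "\<exists>b' \<in> Hom C T (Dom C k'). k \<cdot> b = k' \<cdot> b'"
proof -
  obtain h where h: "h \<in> Hom C (Dom C k) (Dom C k')" "k = k' \<cdot> h"
    using le unfolding mono_le_def by blast
  have "k \<cdot> b = k' \<cdot> (h \<cdot> b)"
    using Comp_assoc[OF b h(1) arr_Hom[OF M_arr[OF subobjectsD(1)[OF k']]]] h(2) by simp
  then show ?thesis
    using Comp_closed[OF b h(1)] by blast
qed

lemma image_subobject:
  assumes f: "f \<in> Hom C X Y" and m: "m \<in> subobjects X"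
    and fact: "is_factorization C E M (f \<cdot> m) e n"
  shows "n \<in> subobjects Y"
proof -
  have "m \<in> Hom C (Dom C m) X"
    using arr_Hom[OF M_arr] subobjectsD[OF m] by metis
  note fm = HomD[OF Comp_closed[OF this f]]
  show ?thesis
    using factorizationD[OF fact] fm HomD[of n] by (auto simp: subobjects_def)
qed

text \<open>The \<open>M\<close>-parts of \<open>f \<cdot> m\<close> and \<open>f \<cdot> m'\<close> are comparable as soon as \<open>m\<close> and \<open>m'\<close> are, since
  \<open>f \<cdot> m\<close> then factors through the second one. Saturation under equivalence is
  \<open>factorization_equiv\<close>: an isomorphism can be moved into the \<open>E\<close>-part.\<close>

lemma sub_image_in_carrier:
  assumes f: "f \<in> Hom C X Y" and p: "p \<in> carrier (Sub C M X)"
  shows "sub_image C E M f p \<in> carrier (Sub C M Y)"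
proof (rule carrier_SubI)
  obtain m where m: "m \<in> p"
    using carrier_SubD(1)[OF p] by blast
  have "m \<in> Hom C (Dom C m) X"
    using arr_Hom[OF M_arr] subobjectsD[OF carrier_SubD(2)[OF p m]] by metis
  then have "f \<cdot> m \<in> Arr C"
    using Comp_closed[OF _ f] HomD by metis
  then show "sub_image C E M f p \<noteq> {}"
    using factorization_exists m unfolding sub_image_def by blast
next
  fix n assume "n \<in> sub_image C E M f p"
  then obtain m e where m: "m \<in> p" and fact: "is_factorization C E M (f \<cdot> m) e n"
    unfolding sub_image_def by blast
  have ms: "m \<in> subobjects X"
    using p m by (rule carrier_SubD(2))
  show ns: "n \<in> subobjects Y"
    using f ms fact by (rule image_subobject)
  {
    fix n' assume "n' \<in> sub_image C E M f p"
    then obtain m' e' where m': "m' \<in> p" and fact': "is_factorization C E M (f \<cdot> m') e' n'"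
      unfolding sub_image_def by blast
    have ms': "m' \<in> subobjects X"
      using p m' by (rule carrier_SubD(2))
    have ns': "n' \<in> subobjects Y"
      using f ms' fact' by (rule image_subobject)
    obtain h where h: "h \<in> Hom C (Dom C m) (Dom C m')" "m = m' \<cdot> h"
      using carrier_SubD(3)[OF p m m'] unfolding mono_le_def by blast
    have "mono_le C n' n'"
      using mono_le_refl[OF M_arr[OF subobjectsD(1)[OF ns']]] .
    then obtain b where b: "b \<in> Hom C (Dom C m') (Dom C n')" "f \<cdot> m' = n' \<cdot> b"
      using image_le_iff[OF f ms' ns' fact'] by blast
    have m'H: "m' \<in> Hom C (Dom C m') X" and n'H: "n' \<in> Hom C (Dom C n') Y"
      using arr_Hom[OF M_arr] subobjectsD[OF ms'] subobjectsD[OF ns'] by metis+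
    have "f \<cdot> m = n' \<cdot> (b \<cdot> h)"
      using Comp_assoc[OF h(1) m'H f] Comp_assoc[OF h(1) b(1) n'H] h(2) b(2) by simp
    then show "mono_le C n n'"
      using image_le_iff[OF f ms ns' fact] Comp_closed[OF h(1) b(1)] by blast
  next
    fix n' assume "n' \<in> subobjects Y" "mono_le C n n'" "mono_le C n' n"
    then show "n' \<in> sub_image C E M f p"
      using factorization_equiv[OF fact] m subobjectsD(1) unfolding sub_image_def by blast
  }
qed

text \<open>Comparability of two pullbacks is \<open>le_preimage_iff\<close>. For saturation, a monomorphism equivalent
  to a pullback of \<open>k\<close> is itself a pullback of the same \<open>k\<close>.\<close>

lemma sub_preimage_in_carrier:
  assumes lim: "finitely_complete C" and f: "f \<in> Hom C X Y" and q: "q \<in> carrier (Sub C M Y)"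
  shows "sub_preimage C f q \<in> carrier (Sub C M X)"
proof (rule carrier_SubI)
  obtain k where k: "k \<in> q"
    using carrier_SubD(1)[OF q] by blast
  note ks = subobjectsD[OF carrier_SubD(2)[OF q k]]
  show "sub_preimage C f q \<noteq> {}"
    using pullback_exists[OF lim _ M_arr[OF ks(1)]] ks(2) HomD[OF f] k
    unfolding sub_preimage_def by blast
next
  fix r assume "r \<in> sub_preimage C f q"
  then obtain k g where k: "k \<in> q" and pb: "is_pullback C f k r g"
    unfolding sub_preimage_def by blast
  have ks: "k \<in> subobjects Y"
    using q k by (rule carrier_SubD(2))
  note P = pullbackD[OF pb]
  have rM: "r \<in> M"
    using pb subobjectsD(1)[OF ks] by (rule pullback_in_M)
  show rs: "r \<in> subobjects X"
    using rM HomD[OF P(1)] HomD[OF f] by (simp add: subobjects_def)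
  {
    fix r' assume "r' \<in> sub_preimage C f q"
    then obtain k' g' where k': "k' \<in> q" and pb': "is_pullback C f k' r' g'"
      unfolding sub_preimage_def by blast
    have ks': "k' \<in> subobjects Y"
      using q k' by (rule carrier_SubD(2))
    show "mono_le C r r'"
      unfolding le_preimage_iff[OF rs ks' pb' f]
      using factor_through_mono[OF ks ks' carrier_SubD(3)[OF q k k'] P(2)] P(3) by simp
  next
    fix r' assume r': "r' \<in> subobjects X" "mono_le C r r'" "mono_le C r' r"
    obtain h where h: "h \<in> Hom C (Dom C r) (Dom C r')" "r = r' \<cdot> h"
      using r'(2) unfolding mono_le_def by blast
    obtain b where b: "b \<in> Hom C (Dom C r') (Dom C k)" "f \<cdot> r' = k \<cdot> b"
      using r'(3) le_preimage_iff[OF r'(1) ks pb f] by blast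
    have r'H: "r' \<in> Hom C (Dom C r') X"
      using arr_Hom[OF M_arr] subobjectsD[OF r'(1)] by metis
    have "is_pullback C f k r' b"
    proof (rule pullback_monoI)
      fix T a b'
      assume "a \<in> Hom C T (Dom C f)" "b' \<in> Hom C T (Dom C k)" "f \<cdot> a = k \<cdot> b'"
      then obtain l where l: "l \<in> Hom C T (Dom C r)" "r \<cdot> l = a"
        using pullback_factor[OF pb] by metis
      then have "r' \<cdot> (h \<cdot> l) = a"
        using Comp_assoc[OF l(1) h(1) r'H] h(2) by simp
      then show "\<exists>l \<in> Hom C T (Dom C r'). r' \<cdot> l = a"
        using Comp_closed[OF l(1) h(1)] by blast
    next
      show "f \<in> Arr C" "Cod C f = Cod C k" "Cod C r' = Dom C f"
        using HomD[OF f] subobjectsD(2)[OF ks] subobjectsD(2)[OF r'(1)] by simp_all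
      show "is_mono C k" "is_mono C r'"
        using ks r'(1) by (simp_all add: M_mono subobjectsD(1))
    qed (rule b)+
    then show "r' \<in> sub_preimage C f q"
      unfolding sub_preimage_def using k by blast
  }
qed

lemma image_preimage_adjoint:
  assumes lim: "finitely_complete C" and f: "f \<in> Hom C X Y"
    and p: "p \<in> carrier (Sub C M X)" and q: "q \<in> carrier (Sub C M Y)"
  shows "sub_image C E M f p \<sqsubseteq>\<^bsub>Sub C M Y\<^esub> q \<longleftrightarrow> p \<sqsubseteq>\<^bsub>Sub C M X\<^esub> sub_preimage C f q"
proof -
  have i: "sub_image C E M f p \<in> carrier (Sub C M Y)"
    using f p by (rule sub_image_in_carrier)
  have r: "sub_preimage C f q \<in> carrier (Sub C M X)"
    using lim f q by (rule sub_preimage_in_carrier)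
  obtain n where n: "n \<in> sub_image C E M f p"
    using carrier_SubD(1)[OF i] by blast
  then obtain m e where m: "m \<in> p" and fact: "is_factorization C E M (f \<cdot> m) e n"
    unfolding sub_image_def by blast
  obtain s where s: "s \<in> sub_preimage C f q"
    using carrier_SubD(1)[OF r] by blast
  then obtain k g where k: "k \<in> q" and pb: "is_pullback C f k s g"
    unfolding sub_preimage_def by blast
  have ms: "m \<in> subobjects X" and ks: "k \<in> subobjects Y"
    using carrier_SubD(2)[OF p m] carrier_SubD(2)[OF q k] .
  show ?thesis
    unfolding le_Sub_iff[OF i q n k] le_Sub_iff[OF p r m s]
      image_le_iff[OF f ms ks fact] le_preimage_iff[OF ms ks pb f] ..
qed

end

section \<open>The closure operation of a preneighbourhood space\<close>

lemma context_proper_factorization: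
  assumes "is_context C E M"
  shows "proper_factorization C E M"
  using assms unfolding is_context_def proper_factorization_def proper_factorization_axioms_def
  by blast

text \<open>For monotonicity, let \<open>p \<sqsubseteq> q\<close>: whatever is far from \<open>q\<close> is far from \<open>p\<close>, and whatever lies
  strictly above \<open>q\<close> lies strictly above \<open>p\<close>.\<close>

lemma cl_extensive_monotone:
  fixes C :: "('o, 'm) cat"
  assumes ctx: "is_context C E M" and space: "preneighbourhood_space C E M X \<mu>"
  shows "extensive_monotone (Sub C M X) (cl C E M X \<mu>)"
proof -
  interpret proper_factorization C E M
    using ctx by (rule context_proper_factorization)
  have X: "X \<in> Obj C" and \<mu>: "preneighbourhood_system C E M X \<mu>"
    using space unfolding preneighbourhood_space_def by auto
  have coprod: "has_finite_coproducts C"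
    using ctx unfolding is_context_def by blast
  let ?L = "Sub C M X" and ?b = "sub_bot C E M X"
  let ?A = "\<lambda>p. {x \<in> carrier ?L. \<not> p \<sqsubset>\<^bsub>?L\<^esub> x \<and> x \<notin> Far C E M X \<mu> p}"
  interpret L: complete_lattice ?L
    using ctx X unfolding is_context_def by blast
  have b: "?b \<in> carrier ?L" and least: "\<And>p. p \<in> carrier ?L \<Longrightarrow> ?b \<sqsubseteq>\<^bsub>?L\<^esub> p"
    by (rule sub_bot_in_carrier[OF coprod X], rule sub_bot_least[OF coprod X])
  have nbd: "u \<in> carrier ?L" "x \<sqsubseteq>\<^bsub>?L\<^esub> u" if "x \<in> carrier ?L" "u \<in> \<mu> x" for u x
  proof -
    have "is_filter ?L (\<mu> x)"
      using \<mu> that(1) unfolding preneighbourhood_system_def by simp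
    then show "u \<in> carrier ?L"
      using that(2) unfolding is_filter_def by blast
    show "x \<sqsubseteq>\<^bsub>?L\<^esub> u"
      using \<mu> that unfolding preneighbourhood_system_def by simp
  qed
  have not_far_mono: "x \<notin> Far C E M X \<mu> q"
    if "x \<notin> Far C E M X \<mu> p" "x \<in> carrier ?L" "p \<in> carrier ?L" "q \<in> carrier ?L" "p \<sqsubseteq>\<^bsub>?L\<^esub> q"
    for p q x
  proof
    assume "x \<in> Far C E M X \<mu> q"
    then obtain u where u: "u \<in> \<mu> x" "u \<sqinter>\<^bsub>?L\<^esub> q = ?b"
      unfolding Far_def by blast
    have uL: "u \<in> carrier ?L"
      using nbd(1)[OF that(2) u(1)] .
    have "u \<sqinter>\<^bsub>?L\<^esub> p \<sqsubseteq>\<^bsub>?L\<^esub> ?b"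
      using L.meet_le[OF L.meet_left[OF uL that(3)] L.le_trans[OF L.meet_right[OF uL that(3)] that(5)]]
        uL that u(2) by simp
    then have "u \<sqinter>\<^bsub>?L\<^esub> p = ?b"
      using L.le_antisym[OF _ least] uL that(3) b by simp
    then show False
      using that(1,2) u(1) unfolding Far_def by blast
  qed
  have self_far: "p = ?b" if p: "p \<in> carrier ?L" and far: "p \<in> Far C E M X \<mu> p" for p
  proof -
    obtain u where u: "u \<in> \<mu> p" "u \<sqinter>\<^bsub>?L\<^esub> p = ?b"
      using far unfolding Far_def by blast
    have "p \<sqsubseteq>\<^bsub>?L\<^esub> u \<sqinter>\<^bsub>?L\<^esub> p"
      using nbd[OF p u(1)] p by (intro L.meet_le L.le_refl)
    then show ?thesis
      using u(2) L.le_antisym[OF _ least[OF p] p b] by simp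
  qed
  show ?thesis
  proof
    fix p assume p: "p \<in> carrier ?L"
    show cl: "cl C E M X \<mu> p \<in> carrier ?L"
      unfolding cl_def by (rule L.sup_closed) blast
    show "p \<sqsubseteq>\<^bsub>?L\<^esub> cl C E M X \<mu> p"
    proof (cases "p = ?b")
      case True
      then show ?thesis
        using least[OF cl] by simp
    next
      case False
      then have "p \<in> ?A p"
        using p self_far by (auto simp: L.lless_eq)
      then show ?thesis
        unfolding cl_def by (intro L.sup_upper) auto
    qed
  next
    fix p q assume pq: "p \<in> carrier ?L" "q \<in> carrier ?L" "p \<sqsubseteq>\<^bsub>?L\<^esub> q"
    have "\<not> q \<sqsubset>\<^bsub>?L\<^esub> x" if "x \<in> carrier ?L" "\<not> p \<sqsubset>\<^bsub>?L\<^esub> x" for x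
    proof
      assume qx: "q \<sqsubset>\<^bsub>?L\<^esub> x"
      then have le: "q \<sqsubseteq>\<^bsub>?L\<^esub> x"
        by (simp add: lless_def)
      then have "p \<sqsubseteq>\<^bsub>?L\<^esub> x"
        using L.le_trans[OF pq(3) _ pq(1,2) that(1)] by simp
      then have "p = x"
        using that(2) by (simp add: L.lless_eq)
      then have "q = x"
        using L.le_antisym[OF le _ pq(2) that(1)] pq(3) by simp
      then show False
        using qx by (simp add: L.lless_eq)
    qed
    then have "?A p \<subseteq> ?A q"
      using not_far_mono pq by blast
    then show "cl C E M X \<mu> p \<sqsubseteq>\<^bsub>?L\<^esub> cl C E M X \<mu> q"
      unfolding cl_def by (intro L.sup_least L.sup_closed L.sup_upper) auto
  qed
qed

section \<open>Continuity\<close>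

theorem mainTheorem6:
  fixes C :: "('o, 'm) cat"
    and E M :: "'m set"
    and X Y :: 'o
    and \<mu> \<phi> :: "'m set \<Rightarrow> 'm set set"
    and f :: 'm
  assumes "is_context C E M"
    and "preneighbourhood_space C E M X \<mu>"
    and "preneighbourhood_space C E M Y \<phi>"
    and "f \<in> Hom C X Y"
  shows
    "let a = (\<forall>p \<in> carrier (Sub C M X).
                sub_image C E M f (cl C E M X \<mu> p)
                  \<sqsubseteq>\<^bsub>Sub C M Y\<^esub> cl C E M Y \<phi> (sub_image C E M f p));
         b = (\<forall>p \<in> carrier (Sub C M X).
                sub_image C E M f (cl_hat C E M X \<mu> p)
                  \<sqsubseteq>\<^bsub>Sub C M Y\<^esub> cl_hat C E M Y \<phi> (sub_image C E M f p));
         c = (\<forall>t \<in> Closed C E M Y \<phi>. sub_preimage C f t \<in> Closed C E M X \<mu>);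
         d = (\<forall>p \<in> carrier (Sub C M X).
                cl_hat C E M Y \<phi> (sub_image C E M f p)
                  = cl_hat C E M Y \<phi> (sub_image C E M f (cl C E M X \<mu> p)))
     in (a \<longrightarrow> b) \<and> (b \<longleftrightarrow> c) \<and> (c \<longleftrightarrow> d)"
proof -
  interpret proper_factorization C E M
    using assms(1) by (rule context_proper_factorization)
  have lim: "finitely_complete C"
    using assms(1) unfolding is_context_def by blast
  interpret adjunction_of_operators "Sub C M X" "cl C E M X \<mu>" "Sub C M Y" "cl C E M Y \<phi>"
    "sub_image C E M f" "sub_preimage C f"
    by (intro adjunction_of_operators.intro adjunction_of_operators_axioms.intro
        cl_extensive_monotone assms(1-3) sub_image_in_carrier[OF assms(4)]
        sub_preimage_in_carrier[OF lim assms(4)] image_preimage_adjoint[OF lim assms(4)])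
  have fixed: "dom.fixed = Closed C E M X \<mu>" "cod.fixed = Closed C E M Y \<phi>"
    by (simp_all add: dom.fixed_def cod.fixed_def Closed_def)
  have hull: "dom.hull = cl_hat C E M X \<mu>" "cod.hull = cl_hat C E M Y \<phi>"
    by (simp_all add: fun_eq_iff dom.hull_def cod.hull_def cl_hat_def fixed)
  show ?thesis
    unfolding Let_def
    using op_continuous_imp_preimage_fixed hull_continuous_iff_preimage_fixed
      preimage_fixed_iff_hull_eq
    unfolding fixed hull by blast
qed

end
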